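(* Let $M$ and $P$ be terms of the symmetric $\lambda\mu$-calculus. If $M\triangleright^* P$, then $M\triangleright_{st} P$; that is, there is a standard sequence of terms starting with $M$ and ending with $P$.
   Context: Terms of the (untyped) symmetric $\lambda\mu$-calculus are given by the grammar $\mathcal T ::= x \mid \lambda x\,\mathcal T \mid (\mathcal T\;\mathcal T) \mid \mu\alpha\,\mathcal T \mid (\alpha\;\mathcal T)$, where $x,y,\dots$ range over $\lambda$-variables and $\alpha,\beta,\dots$ over $\mu$-variables ($\lambda x$ binds $x$, $\mu\alpha$ binds $\alpha$; terms are taken up to renaming of bound variables, and substitutions are capture-avoiding). One-step reduction $\triangleright$ is the closure under all term contexts of the three rules ($\beta$) $(\lambda x M\;N)\triangleright M[x:=N]$; ($\mu$) $(\mu\alpha M\;N)\triangleright \mu\alpha\, M[\alpha=_r N]$; ($\mu'$) $(M\;\mu\alpha N)\triangleright \mu\alpha\, N[\alpha=_l M]$. Here $M[\alpha=_r N]$ is obtained from $M$ by (recursively) replacing each sub-term of $M$ of the form $(\alpha\;U)$ ($\alpha$ free) by $(\alpha\;(U\;N))$, and $N[\alpha=_l M]$ is obtained from $N$ by (recursively) replacing each sub-term of $N$ of the form $(\alpha\;U)$ by $(\alpha\;(M\;U))$. $\triangleright^*$ is the reflexive transitive closure of $\triangleright$. Standard sequences. A finite sequence of terms $(M_i)_{1\le i\le n}$ ($n\ge 1$) is standard iff one of the following holds (definition by induction on the pair consisting of $n$ and the number of symbols of $M_1$, ordered lexicographically): (0) $n=1$ and $M_1$ is a $\lambda$-variable.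 (a) For all $i$, $M_i=\lambda x N_i$ (resp. for all $i$, $M_i=\mu\alpha N_i$; resp. for all $i$, $M_i=(x\;N_i)$; resp. for all $i$, $M_i=(\alpha\;N_i)$) and the sequence $(N_i)_{1\le i\le n}$ is standard. (b) There are standard sequences $(N_i)_{1\le i\le k}$ and $(P_i)_{k\le i\le n}$ such that $M_i=(N_i\;P_k)$ for $1\le i\le k$ and $M_i=(N_k\;P_i)$ for $k\le i\le n$. (c) There are a standard sequence $(N_i)_{1\le i\le k}$ and a term $Q$ such that one of the following holds (the condition on $N_{k-1}$ being void if $k=1$): (i) $M_i=(N_i\;Q)$ for $1\le i\le k$, $N_k=\lambda x P$, $N_{k-1}$ does not begin with $\lambda$, $M_{k+1}=P[x:=Q]$, and the sequence $(M_i)_{k+1\le i\le n}$ is standard; (ii) $M_i=(N_i\;Q)$ for $1\le i\le k$, $N_k=\mu\alpha P$, $N_{k-1}$ does not begin with $\mu$, $M_{k+1}=\mu\alpha\,P[\alpha=_r Q]$, and the sequence $(M_i)_{k+1\le i\le n}$ is standard; (iii) $M_i=(Q\;N_i)$ for $1\le i\le k$, $N_k=\mu\beta P$, $N_{k-1}$ does not begin with $\mu$, $M_{k+1}=\mu\beta\,P[\beta=_l Q]$, and the sequence $(M_i)_{k+1\le i\le n}$ is standard. $M\triangleright_{st}M'$ means that there is a standard sequence $(M_i)_{1\le i\le n}$ with $M=M_1$ and $M'=M_n$. *)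

theory Defs imports Main begin

text \<open>Terms modulo renaming of bound variables, in de Bruijn form. There are two independent index
  spaces: \<open>Lam\<close> binds the index 0 of the space of \<open>\<lambda>\<close>-variables (occurring as \<open>Var i\<close>), \<open>Mu\<close> binds
  the index 0 of the space of \<open>\<mu>\<close>-variables (occurring as the head of \<open>Named a t\<close>, the term
  written \<open>(\<alpha> t)\<close> on paper). Indices that exceed the number of enclosing binders of their kind are
  free variables.\<close>

datatype trm =
    Var nat
  | Lam trm
  | App trm trm
  | Mu trm
  | Named nat trm

primrec lift_lam :: "trm \<Rightarrow> nat \<Rightarrow> trm" where
  "lift_lam (Var i) k = Var (if i < k then i else Suc i)"
| "lift_lam (Lam t) k = Lam (lift_lam t (Suc k))"
| "lift_lam (App t u) k = App (lift_lam t k) (lift_lam u k)"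
| "lift_lam (Mu t) k = Mu (lift_lam t k)"
| "lift_lam (Named a t) k = Named a (lift_lam t k)"

primrec lift_mu :: "trm \<Rightarrow> nat \<Rightarrow> trm" where
  "lift_mu (Var i) k = Var i"
| "lift_mu (Lam t) k = Lam (lift_mu t k)"
| "lift_mu (App t u) k = App (lift_mu t k) (lift_mu u k)"
| "lift_mu (Mu t) k = Mu (lift_mu t (Suc k))"
| "lift_mu (Named a t) k = Named (if a < k then a else Suc a) (lift_mu t k)"

text \<open>\<open>subst_lam M N k\<close> is \<open>M[x := N]\<close> where \<open>x\<close> is the \<open>\<lambda>\<close>-variable with index \<open>k\<close>. The binder of \<open>x\<close>
  disappears in a \<open>\<beta>\<close>-step, so larger indices are decremented.\<close>

primrec subst_lam :: "trm \<Rightarrow> trm \<Rightarrow> nat \<Rightarrow> trm" where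
  "subst_lam (Var i) N k = (if i < k then Var i else if i = k then N else Var (i - 1))"
| "subst_lam (Lam t) N k = Lam (subst_lam t (lift_lam N 0) (Suc k))"
| "subst_lam (App t u) N k = App (subst_lam t N k) (subst_lam u N k)"
| "subst_lam (Mu t) N k = Mu (subst_lam t (lift_mu N 0) k)"
| "subst_lam (Named a t) N k = Named a (subst_lam t N k)"

text \<open>\<open>subst_r M N k\<close> and \<open>subst_l M N k\<close> are \<open>M[\<alpha> =\<^sub>r N]\<close> and \<open>M[\<alpha> =\<^sub>l N]\<close> where \<open>\<alpha>\<close> is the
  \<open>\<mu>\<close>-variable with index \<open>k\<close>. Here \<open>\<alpha>\<close> persists and remains bound by the same \<open>\<mu>\<close>, so no index is
  decremented, and \<open>N\<close> has to be given in the scope of that \<open>\<mu>\<close>, i.e. lifted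
  (see \<open>contract_r\<close> and \<open>contract_l\<close>).\<close>

primrec subst_r :: "trm \<Rightarrow> trm \<Rightarrow> nat \<Rightarrow> trm" where
  "subst_r (Var i) N k = Var i"
| "subst_r (Lam t) N k = Lam (subst_r t (lift_lam N 0) k)"
| "subst_r (App t u) N k = App (subst_r t N k) (subst_r u N k)"
| "subst_r (Mu t) N k = Mu (subst_r t (lift_mu N 0) (Suc k))"
| "subst_r (Named a t) N k =
     (if a = k then Named a (App (subst_r t N k) N) else Named a (subst_r t N k))"

primrec subst_l :: "trm \<Rightarrow> trm \<Rightarrow> nat \<Rightarrow> trm" where
  "subst_l (Var i) N k = Var i"
| "subst_l (Lam t) N k = Lam (subst_l t (lift_lam N 0) k)"
| "subst_l (App t u) N k = App (subst_l t N k) (subst_l u N k)"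
| "subst_l (Mu t) N k = Mu (subst_l t (lift_mu N 0) (Suc k))"
| "subst_l (Named a t) N k =
     (if a = k then Named a (App N (subst_l t N k)) else Named a (subst_l t N k))"

text \<open>For the body \<open>P\<close> of an abstraction, the contracta of \<open>(\<lambda>x P Q)\<close>, \<open>(\<mu>\<alpha> P Q)\<close> and \<open>(Q \<mu>\<alpha> P)\<close>.\<close>

definition contract_beta :: "trm \<Rightarrow> trm \<Rightarrow> trm" where
  "contract_beta P Q = subst_lam P Q 0"

definition contract_r :: "trm \<Rightarrow> trm \<Rightarrow> trm" where
  "contract_r P Q = Mu (subst_r P (lift_mu Q 0) 0)"

definition contract_l :: "trm \<Rightarrow> trm \<Rightarrow> trm" where
  "contract_l P Q = Mu (subst_l P (lift_mu Q 0) 0)"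

inductive red :: "trm \<Rightarrow> trm \<Rightarrow> bool"  (infix \<open>\<rhd>\<close> 50) where
  beta: "App (Lam M) N \<rhd> contract_beta M N"
| mu: "App (Mu M) N \<rhd> contract_r M N"
| mu': "App M (Mu N) \<rhd> contract_l N M"
| Lam: "M \<rhd> M' \<Longrightarrow> Lam M \<rhd> Lam M'"
| App1: "M \<rhd> M' \<Longrightarrow> App M N \<rhd> App M' N"
| App2: "N \<rhd> N' \<Longrightarrow> App M N \<rhd> App M N'"
| Mu: "M \<rhd> M' \<Longrightarrow> Mu M \<rhd> Mu M'"
| Named: "M \<rhd> M' \<Longrightarrow> Named a M \<rhd> Named a M'"

abbreviation reds :: "trm \<Rightarrow> trm \<Rightarrow> bool"  (infix \<open>\<rhd>\<^sup>*\<close> 50) where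
  "M \<rhd>\<^sup>* N \<equiv> red\<^sup>*\<^sup>* M N"

definition begins_lam :: "trm \<Rightarrow> bool" where
  "begins_lam M \<longleftrightarrow> (\<exists>P. M = Lam P)"

definition begins_mu :: "trm \<Rightarrow> bool" where
  "begins_mu M \<longleftrightarrow> (\<exists>P. M = Mu P)"

text \<open>A sequence \<open>M\<^sub>1, \<dots>, M\<^sub>n\<close> is the list of its members. The recursion in the definition of standard
  sequences is well-founded (length, then size of the first term), so the inductive predicate is the
  only solution of the defining clauses. In \<open>std_app\<close> the two given sequences are
  \<open>N\<^sub>1, \<dots>, N\<^sub>k\<close> = \<open>Ns @ [N]\<close> and \<open>P\<^sub>k, \<dots>, P\<^sub>n\<close> = \<open>P # Ps\<close>, and the member \<open>(N\<^sub>k P\<^sub>k)\<close> occurs once in the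
  result. In the last three rules, \<open>N\<^sub>k\<close> is the abstraction at the end and \<open>N\<^bsub>k-1\<^esub>\<close> is
  \<open>last Ns\<close>, if it exists.\<close>

inductive standard :: "trm list \<Rightarrow> bool" where
  std_var: "standard [Var x]"
| std_lam: "standard Ns \<Longrightarrow> standard (map Lam Ns)"
| std_mu: "standard Ns \<Longrightarrow> standard (map Mu Ns)"
| std_var_app: "standard Ns \<Longrightarrow> standard (map (App (Var x)) Ns)"
| std_named: "standard Ns \<Longrightarrow> standard (map (Named a) Ns)"
| std_app: "standard (Ns @ [N]) \<Longrightarrow> standard (P # Ps) \<Longrightarrow>
    standard (map (\<lambda>N'. App N' P) (Ns @ [N]) @ map (\<lambda>P'. App N P') Ps)"
| std_beta: "standard (Ns @ [Lam P]) \<Longrightarrow> (Ns \<noteq> [] \<Longrightarrow> \<not> begins_lam (last Ns)) \<Longrightarrow>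
    standard (contract_beta P Q # Ms) \<Longrightarrow>
    standard (map (\<lambda>N. App N Q) (Ns @ [Lam P]) @ contract_beta P Q # Ms)"
| std_r: "standard (Ns @ [Mu P]) \<Longrightarrow> (Ns \<noteq> [] \<Longrightarrow> \<not> begins_mu (last Ns)) \<Longrightarrow>
    standard (contract_r P Q # Ms) \<Longrightarrow>
    standard (map (\<lambda>N. App N Q) (Ns @ [Mu P]) @ contract_r P Q # Ms)"
| std_l: "standard (Ns @ [Mu P]) \<Longrightarrow> (Ns \<noteq> [] \<Longrightarrow> \<not> begins_mu (last Ns)) \<Longrightarrow>
    standard (contract_l P Q # Ms) \<Longrightarrow>
    standard (map (\<lambda>N. App Q N) (Ns @ [Mu P]) @ contract_l P Q # Ms)"

definition st_red :: "trm \<Rightarrow> trm \<Rightarrow> bool"  (infix \<open>\<rhd>\<^sub>s\<^sub>t\<close> 50) where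
  "M \<rhd>\<^sub>s\<^sub>t M' \<longleftrightarrow> (\<exists>Ms. standard Ms \<and> Ms \<noteq> [] \<and> hd Ms = M \<and> last Ms = M')"

end

theory Submission imports Defs begin

text \<open>Standard reduction is generated by a binary relation \<open>\<Rightarrow>\<^sub>s\<close> that first fires head redexes
  and then descends into the subterms; the first arrival at an abstraction is isolated in a relation
  \<open>\<rightarrow>\<^sub>h\<close>. Both relations are stable under lifting and under the three substitutions. A standard
  reduction to an abstraction factors through \<open>\<rightarrow>\<^sub>h\<close>, so a further redex contracted at the end of a
  standard reduction can be moved to the front, and \<open>\<Rightarrow>\<^sub>s\<close> absorbs one-step reductions on the right.
  This never needs confluence, which fails in the symmetric calculus.\<close>

section \<open>Lifting and substitution\<close>

text \<open>The flag selects the side on which the argument of a \<open>\<mu>\<close>-redex stands: \<open>True\<close> for the rule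
  \<open>\<mu>\<close>, \<open>False\<close> for the rule \<open>\<mu>'\<close>.\<close>

definition app_side :: "bool \<Rightarrow> trm \<Rightarrow> trm \<Rightarrow> trm" where
  "app_side s t N = (if s then App t N else App N t)"

definition subst_mu :: "bool \<Rightarrow> trm \<Rightarrow> trm \<Rightarrow> nat \<Rightarrow> trm" where
  "subst_mu s = (if s then subst_r else subst_l)"

definition contract_mu :: "bool \<Rightarrow> trm \<Rightarrow> trm \<Rightarrow> trm" where
  "contract_mu s P Q = Mu (subst_mu s P (lift_mu Q 0) 0)"

lemma contract_mu_True: "contract_mu True = contract_r"
  by (simp add: fun_eq_iff contract_mu_def contract_r_def subst_mu_def)

lemma contract_mu_False: "contract_mu False = contract_l"
  by (simp add: fun_eq_iff contract_mu_def contract_l_def subst_mu_def)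

lemma subst_mu_simps [simp]:
  "subst_mu s (Var i) N k = Var i"
  "subst_mu s (Lam t) N k = Lam (subst_mu s t (lift_lam N 0) k)"
  "subst_mu s (App t u) N k = App (subst_mu s t N k) (subst_mu s u N k)"
  "subst_mu s (Mu t) N k = Mu (subst_mu s t (lift_mu N 0) (Suc k))"
  "subst_mu s (Named a t) N k =
     (if a = k then Named a (app_side s (subst_mu s t N k) N) else Named a (subst_mu s t N k))"
  by (simp_all add: subst_mu_def app_side_def)

lemma app_side_distribs [simp]:
  "lift_lam (app_side s t u) k = app_side s (lift_lam t k) (lift_lam u k)"
  "lift_mu (app_side s t u) k = app_side s (lift_mu t k) (lift_mu u k)"
  "subst_lam (app_side s t u) N k = app_side s (subst_lam t N k) (subst_lam u N k)"
  "subst_mu s' (app_side s t u) N k = app_side s (subst_mu s' t N k) (subst_mu s' u N k)"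
  by (simp_all add: app_side_def)

lemma app_side_distinct [simp]:
  "app_side s t u \<noteq> Lam P" "app_side s t u \<noteq> Mu P"
  "Lam P \<noteq> app_side s t u" "Mu P \<noteq> app_side s t u"
  by (simp_all add: app_side_def)

lemma lift_lam_lift_lam:
  "i \<le> k \<Longrightarrow> lift_lam (lift_lam t i) (Suc k) = lift_lam (lift_lam t k) i"
  by (induction t arbitrary: i k) auto

lemma lift_mu_lift_mu:
  "i \<le> k \<Longrightarrow> lift_mu (lift_mu t i) (Suc k) = lift_mu (lift_mu t k) i"
  by (induction t arbitrary: i k) auto

lemma lift_mu_lift_lam: "lift_mu (lift_lam t k) i = lift_lam (lift_mu t i) k"
  by (induction t arbitrary: i k) auto

lemma lift_lam_subst_lam_le:
  "i \<le> k \<Longrightarrow> lift_lam (subst_lam t N k) i = subst_lam (lift_lam t i) (lift_lam N i) (Suc k)"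
  by (induction t arbitrary: i k N) (auto simp: lift_lam_lift_lam lift_mu_lift_lam)

lemma lift_lam_subst_lam_ge:
  "k \<le> i \<Longrightarrow> lift_lam (subst_lam t N k) i = subst_lam (lift_lam t (Suc i)) (lift_lam N i) k"
  by (induction t arbitrary: i k N) (auto simp: lift_lam_lift_lam lift_mu_lift_lam)

lemma lift_mu_subst_lam:
  "lift_mu (subst_lam t N k) i = subst_lam (lift_mu t i) (lift_mu N i) k"
  by (induction t arbitrary: i k N) (auto simp: lift_mu_lift_mu lift_mu_lift_lam)

lemma lift_lam_subst_mu:
  "lift_lam (subst_mu s t N k) i = subst_mu s (lift_lam t i) (lift_lam N i) k"
  by (induction t arbitrary: i k N) (auto simp: lift_lam_lift_lam lift_mu_lift_lam)

text \<open>A structural substitution keeps its variable, so the index \<open>k\<close> only moves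
  up when the fresh index is inserted at or below it. The conditional treats both positions in one
  induction.\<close>

lemma lift_mu_subst_mu:
  "lift_mu (subst_mu s t N k) i = subst_mu s (lift_mu t i) (lift_mu N i) (if i \<le> k then Suc k else k)"
  by (induction t arbitrary: i k N) (auto simp: lift_mu_lift_mu lift_mu_lift_lam)

lemma subst_lam_lift_lam [simp]: "subst_lam (lift_lam t k) N k = t"
  by (induction t arbitrary: k N) auto

lemma subst_mu_lift_mu [simp]: "subst_mu s (lift_mu t k) N k = lift_mu t k"
  by (induction t arbitrary: k N) auto

lemma subst_lam_subst_lam:
  "i \<le> k \<Longrightarrow> subst_lam (subst_lam t A i) N k =
    subst_lam (subst_lam t (lift_lam N i) (Suc k)) (subst_lam A N k) i"
  by (induction t arbitrary: i k A N)
    (auto simp: lift_lam_lift_lam[symmetric] lift_mu_lift_lam lift_lam_subst_lam_le lift_mu_subst_lam)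

text \<open>Writing the outer argument as \<open>lift_mu N i\<close> expresses that the
  \<mu>-variable \<open>i\<close> is not free in it, so copies of it inserted by the outer
  substitution are untouched by the structural one.\<close>

lemma subst_lam_subst_mu:
  "subst_lam (subst_mu s t A i) (lift_mu N i) k =
    subst_mu s (subst_lam t (lift_mu N i) k) (subst_lam A (lift_mu N i) k) i"
  by (induction t arbitrary: i k A N)
    (auto simp: lift_mu_lift_mu[symmetric] lift_mu_lift_lam[symmetric] lift_lam_subst_lam_le
      lift_mu_subst_lam)

lemma subst_mu_subst_lam:
  "subst_mu s (subst_lam t A i) N k =
    subst_lam (subst_mu s t (lift_lam N i) k) (subst_mu s A N k) i"
  by (induction t arbitrary: i k A N)
    (auto simp: lift_lam_lift_lam[symmetric] lift_mu_lift_lam lift_lam_subst_mu lift_mu_subst_mu)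

text \<open>The lifting of \<open>N\<close> again excludes the variable \<open>i\<close>. The flags
  are independent, so left and right substitutions for distinct variables commute in every
  combination.\<close>

lemma subst_mu_subst_mu:
  "i \<noteq> k \<Longrightarrow> subst_mu s (subst_mu s' t A i) (lift_mu N i) k =
    subst_mu s' (subst_mu s t (lift_mu N i) k) (subst_mu s A (lift_mu N i) k) i"
  by (induction t arbitrary: i k A N)
    (auto simp: lift_mu_lift_mu[symmetric] lift_mu_lift_lam[symmetric] lift_lam_subst_mu
      lift_mu_subst_mu)

section \<open>Contracta under lifting and substitution\<close>

lemma lift_lam_contract_beta:
  "lift_lam (contract_beta P Q) k = contract_beta (lift_lam P (Suc k)) (lift_lam Q k)"
  by (simp add: contract_beta_def lift_lam_subst_lam_ge)

lemma lift_mu_contract_beta: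
  "lift_mu (contract_beta P Q) k = contract_beta (lift_mu P k) (lift_mu Q k)"
  by (simp add: contract_beta_def lift_mu_subst_lam)

lemma subst_lam_contract_beta:
  "subst_lam (contract_beta P Q) N k =
    contract_beta (subst_lam P (lift_lam N 0) (Suc k)) (subst_lam Q N k)"
  by (simp add: contract_beta_def subst_lam_subst_lam[of 0])

lemma subst_mu_contract_beta:
  "subst_mu s (contract_beta P Q) N k =
    contract_beta (subst_mu s P (lift_lam N 0) k) (subst_mu s Q N k)"
  by (simp add: contract_beta_def subst_mu_subst_lam)

lemma lift_lam_contract_mu:
  "lift_lam (contract_mu s P Q) k = contract_mu s (lift_lam P k) (lift_lam Q k)"
  by (simp add: contract_mu_def lift_lam_subst_mu lift_mu_lift_lam)

lemma lift_mu_contract_mu: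
  "lift_mu (contract_mu s P Q) k = contract_mu s (lift_mu P (Suc k)) (lift_mu Q k)"
  by (simp add: contract_mu_def lift_mu_subst_mu lift_mu_lift_mu)

lemma subst_lam_contract_mu:
  "subst_lam (contract_mu s P Q) N k =
    contract_mu s (subst_lam P (lift_mu N 0) k) (subst_lam Q N k)"
  by (simp add: contract_mu_def subst_lam_subst_mu lift_mu_subst_lam)

lemma subst_mu_contract_mu:
  "subst_mu s (contract_mu s' P Q) N k =
    contract_mu s' (subst_mu s P (lift_mu N 0) (Suc k)) (subst_mu s Q N k)"
  by (simp add: contract_mu_def subst_mu_subst_mu lift_mu_subst_mu)

section \<open>Head reduction to an abstraction\<close>

text \<open>A \<mu>-contractum is itself an abstraction, so \<open>contract_mu\<close> stops there;
  a \<beta>-contractum may have any shape, so \<open>contract_beta\<close> goes on.\<close>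

inductive head_red :: "trm \<Rightarrow> trm \<Rightarrow> bool"  (infix \<open>\<rightarrow>\<^sub>h\<close> 50) where
  lam: "Lam P \<rightarrow>\<^sub>h Lam P"
| mu: "Mu P \<rightarrow>\<^sub>h Mu P"
| contract_beta: "A \<rightarrow>\<^sub>h Lam P \<Longrightarrow> contract_beta P Q \<rightarrow>\<^sub>h R \<Longrightarrow> App A Q \<rightarrow>\<^sub>h R"
| contract_mu: "A \<rightarrow>\<^sub>h Mu P \<Longrightarrow> app_side s A Q \<rightarrow>\<^sub>h contract_mu s P Q"

lemma head_red_lift_lam: "A \<rightarrow>\<^sub>h R \<Longrightarrow> lift_lam A k \<rightarrow>\<^sub>h lift_lam R k"
  by (induction arbitrary: k rule: head_red.induct)
    (auto simp: lift_lam_contract_beta lift_lam_contract_mu intro: head_red.intros)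

lemma head_red_lift_mu: "A \<rightarrow>\<^sub>h R \<Longrightarrow> lift_mu A k \<rightarrow>\<^sub>h lift_mu R k"
  by (induction arbitrary: k rule: head_red.induct)
    (auto simp: lift_mu_contract_beta lift_mu_contract_mu intro: head_red.intros)

text \<open>Only abstractions and applications start a head reduction. Substitution preserves both
  shapes and commutes with contraction, so every head redex survives.\<close>

lemma head_red_subst_lam: "A \<rightarrow>\<^sub>h R \<Longrightarrow> subst_lam A N k \<rightarrow>\<^sub>h subst_lam R N k"
proof (induction arbitrary: N k rule: head_red.induct)
  case (contract_beta A P Q R)
  from contract_beta.IH(1)[of N k] contract_beta.IH(2)[of N k] show ?case
    by (simp add: subst_lam_contract_beta head_red.contract_beta)
qed (auto simp: subst_lam_contract_mu intro: head_red.intros)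

lemma head_red_subst_mu: "A \<rightarrow>\<^sub>h R \<Longrightarrow> subst_mu s A N k \<rightarrow>\<^sub>h subst_mu s R N k"
proof (induction arbitrary: N k rule: head_red.induct)
  case (contract_beta A P Q R)
  from contract_beta.IH(1)[of N k] contract_beta.IH(2)[of N k] show ?case
    by (simp add: subst_mu_contract_beta head_red.contract_beta)
qed (auto simp: subst_mu_contract_mu intro: head_red.intros)

section \<open>Standard reduction as a binary relation\<close>

inductive std_red :: "trm \<Rightarrow> trm \<Rightarrow> bool"  (infix \<open>\<Rightarrow>\<^sub>s\<close> 50) where
  var: "Var x \<Rightarrow>\<^sub>s Var x"
| lam: "M \<Rightarrow>\<^sub>s M' \<Longrightarrow> Lam M \<Rightarrow>\<^sub>s Lam M'"
| app: "M \<Rightarrow>\<^sub>s M' \<Longrightarrow> N \<Rightarrow>\<^sub>s N' \<Longrightarrow> App M N \<Rightarrow>\<^sub>s App M' N'"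
| mu: "M \<Rightarrow>\<^sub>s M' \<Longrightarrow> Mu M \<Rightarrow>\<^sub>s Mu M'"
| named: "M \<Rightarrow>\<^sub>s M' \<Longrightarrow> Named a M \<Rightarrow>\<^sub>s Named a M'"
| contract_beta: "A \<rightarrow>\<^sub>h Lam P \<Longrightarrow> contract_beta P Q \<Rightarrow>\<^sub>s R \<Longrightarrow> App A Q \<Rightarrow>\<^sub>s R"
| contract_mu: "A \<rightarrow>\<^sub>h Mu P \<Longrightarrow> contract_mu s P Q \<Rightarrow>\<^sub>s R \<Longrightarrow> app_side s A Q \<Rightarrow>\<^sub>s R"

lemma std_red_refl: "M \<Rightarrow>\<^sub>s M"
  by (induction M) (auto intro: std_red.intros)

lemma std_red_app_side: "M \<Rightarrow>\<^sub>s M' \<Longrightarrow> N \<Rightarrow>\<^sub>s N' \<Longrightarrow> app_side s M N \<Rightarrow>\<^sub>s app_side s M' N'"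
  by (auto simp: app_side_def intro: std_red.app)

lemma std_red_lift_lam: "M \<Rightarrow>\<^sub>s M' \<Longrightarrow> lift_lam M k \<Rightarrow>\<^sub>s lift_lam M' k"
proof (induction arbitrary: k rule: std_red.induct)
  case (contract_beta A P Q R)
  then show ?case
    using head_red_lift_lam[OF contract_beta.hyps(1), of k]
    by (auto simp: lift_lam_contract_beta intro: std_red.contract_beta)
next
  case (contract_mu A P s Q R)
  then show ?case
    using head_red_lift_lam[OF contract_mu.hyps(1), of k]
    by (auto simp: lift_lam_contract_mu intro: std_red.contract_mu)
qed (auto intro: std_red.intros)

lemma std_red_lift_mu: "M \<Rightarrow>\<^sub>s M' \<Longrightarrow> lift_mu M k \<Rightarrow>\<^sub>s lift_mu M' k"
proof (induction arbitrary: k rule: std_red.induct)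
  case (contract_beta A P Q R)
  then show ?case
    using head_red_lift_mu[OF contract_beta.hyps(1), of k]
    by (auto simp: lift_mu_contract_beta intro: std_red.contract_beta)
next
  case (contract_mu A P s Q R)
  then show ?case
    using head_red_lift_mu[OF contract_mu.hyps(1), of k]
    by (auto simp: lift_mu_contract_mu intro: std_red.contract_mu)
qed (auto intro: std_red.intros)

text \<open>Head redexes of \<open>M\<close> persist with the unreduced \<open>N\<close> substituted
  and are still fired first; the reduction from \<open>N\<close> to \<open>N'\<close> is inserted at
  the variable occurrences, once the structural rules reach them.\<close>

lemma std_red_subst_lam:
  "M \<Rightarrow>\<^sub>s M' \<Longrightarrow> N \<Rightarrow>\<^sub>s N' \<Longrightarrow> subst_lam M N k \<Rightarrow>\<^sub>s subst_lam M' N' k"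
proof (induction arbitrary: N N' k rule: std_red.induct)
  case (contract_beta A P Q R)
  then show ?case
    using head_red_subst_lam[OF contract_beta.hyps(1), of N k]
    by (auto simp: subst_lam_contract_beta intro: std_red.contract_beta)
next
  case (contract_mu A P s Q R)
  then show ?case
    using head_red_subst_lam[OF contract_mu.hyps(1), of N k]
    by (auto simp: subst_lam_contract_mu intro: std_red.contract_mu)
qed (simp_all add: std_red.var std_red.lam std_red.app std_red.mu std_red.named
    std_red_lift_lam std_red_lift_mu)

lemma std_red_subst_mu:
  "M \<Rightarrow>\<^sub>s M' \<Longrightarrow> N \<Rightarrow>\<^sub>s N' \<Longrightarrow> subst_mu s M N k \<Rightarrow>\<^sub>s subst_mu s M' N' k"
proof (induction arbitrary: N N' k rule: std_red.induct)
  case (contract_beta A P Q R)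
  then show ?case
    using head_red_subst_mu[OF contract_beta.hyps(1), of s N k]
    by (auto simp: subst_mu_contract_beta intro: std_red.contract_beta)
next
  case (contract_mu A P s' Q R)
  then show ?case
    using head_red_subst_mu[OF contract_mu.hyps(1), of s N k]
    by (auto simp: subst_mu_contract_mu intro: std_red.contract_mu)
qed (simp_all add: std_red.var std_red.lam std_red.app std_red.mu std_red.named
    std_red_app_side std_red_lift_lam std_red_lift_mu)

section \<open>Absorbing a step on the right\<close>

lemma std_red_contract_beta:
  "P \<Rightarrow>\<^sub>s P' \<Longrightarrow> Q \<Rightarrow>\<^sub>s Q' \<Longrightarrow> contract_beta P Q \<Rightarrow>\<^sub>s contract_beta P' Q'"
  by (simp add: contract_beta_def std_red_subst_lam)

lemma std_red_contract_mu:
  "P \<Rightarrow>\<^sub>s P' \<Longrightarrow> Q \<Rightarrow>\<^sub>s Q' \<Longrightarrow> contract_mu s P Q \<Rightarrow>\<^sub>s contract_mu s P' Q'"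
  by (simp add: contract_mu_def std_red.mu std_red_subst_mu std_red_lift_mu)

inductive_cases std_red_from_Mu: "Mu M \<Rightarrow>\<^sub>s R"

text \<open>Head contractions come first, so whatever follows the arrival at an abstraction happens
  in its body. The case \<open>contract_mu\<close> is void: its contractum begins with \<mu>, and
  this is never lost.\<close>

lemma std_red_LamD: "M \<Rightarrow>\<^sub>s Lam P \<Longrightarrow> \<exists>P0. M \<rightarrow>\<^sub>h Lam P0 \<and> P0 \<Rightarrow>\<^sub>s P"
  by (induction M "Lam P" rule: std_red.induct)
    (auto simp: contract_mu_def intro: head_red.intros elim: std_red_from_Mu)

lemma std_red_MuD: "M \<Rightarrow>\<^sub>s Mu P \<Longrightarrow> \<exists>P0. M \<rightarrow>\<^sub>h Mu P0 \<and> P0 \<Rightarrow>\<^sub>s P"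
proof (induction M "Mu P" rule: std_red.induct)
  case (contract_mu A P' s Q)
  \<comment> \<open>The contractum already begins with \<mu>, so the head reduction ends here;
    inversion leaves the reduction of its body.\<close>
  from contract_mu.hyps(2) have "subst_mu s P' (lift_mu Q 0) 0 \<Rightarrow>\<^sub>s P"
    by (auto simp: contract_mu_def elim: std_red_from_Mu)
  with head_red.contract_mu[OF contract_mu.hyps(1), of s Q] show ?case
    by (auto simp: contract_mu_def)
qed (auto intro: head_red.intros)

text \<open>The \<mu>-redex that appears at the end is fired as soon as \<open>M\<close> arrives at
  an abstraction; the reductions of its body and of \<open>N\<close> are then carried out in the
  contractum.\<close>

lemma std_red_app_side_Mu:
  assumes "M \<Rightarrow>\<^sub>s Mu P" "N \<Rightarrow>\<^sub>s N'"
  shows "app_side s M N \<Rightarrow>\<^sub>s contract_mu s P N'"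
  using std_red_MuD[OF assms(1)] assms(2)
  by (blast intro: std_red.contract_mu std_red_contract_mu)

inductive_cases red_from_Var: "Var x \<rhd> R"
inductive_cases red_from_Lam: "Lam M \<rhd> R"
inductive_cases red_from_Mu: "Mu M \<rhd> R"
inductive_cases red_from_Named: "Named a M \<rhd> R"

text \<open>A step after a head contraction, or inside a subterm, is absorbed by the induction
  hypothesis. What remains is a redex at the root of \<open>App M' N'\<close>. Its abstraction
  arises from \<open>M\<close> or from \<open>N\<close> alone, so the factorization applies to that
  side, whatever the shape of the other.\<close>

lemma std_red_red: "M \<Rightarrow>\<^sub>s N \<Longrightarrow> N \<rhd> P \<Longrightarrow> M \<Rightarrow>\<^sub>s P"
proof (induction arbitrary: P rule: std_red.induct)
  case (app M M' N N')
  from app.prems show ?case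
  proof (cases rule: red.cases)
    case (beta B)
    with app.hyps std_red_LamD[of M B] show ?thesis
      by (blast intro: std_red.contract_beta std_red_contract_beta)
  next
    case (mu B)
    with app.hyps std_red_app_side_Mu[of M B N N' True] show ?thesis
      by (simp add: app_side_def contract_mu_True)
  next
    case (mu' B)
    with app.hyps std_red_app_side_Mu[of N B M M' False] show ?thesis
      by (simp add: app_side_def contract_mu_False)
  qed (use app in \<open>auto intro: std_red.app\<close>)
qed (auto intro: std_red.intros elim: red_from_Var red_from_Lam red_from_Mu red_from_Named)

lemma reds_imp_std_red: "M \<rhd>\<^sup>* P \<Longrightarrow> M \<Rightarrow>\<^sub>s P"
  by (induction rule: rtranclp_induct) (auto intro: std_red_refl std_red_red)

section \<open>From the binary relations to standard sequences\<close>

lemma standard_single: "standard [M]"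
proof (induction M)
  case (App M N)
  with std_app[of "[]" M N "[]"] show ?case by simp
qed (use std_var std_lam[of "[_]"] std_mu[of "[_]"] std_named[of "[_]"] in auto)

lemma standard_contract_mu:
  assumes "standard (Ns @ [Mu P])" "Ns \<noteq> [] \<Longrightarrow> \<not> begins_mu (last Ns)"
    "standard (contract_mu s P Q # Ms)"
  shows "standard (map (\<lambda>N. app_side s N Q) (Ns @ [Mu P]) @ contract_mu s P Q # Ms)"
  using std_r[of Ns P Q Ms] std_l[of Ns P Q Ms] assms
  by (cases s) (simp_all add: app_side_def contract_mu_True contract_mu_False)

text \<open>Excluding both kinds of abstraction before the end yields the side conditions of all
  three contraction rules. It carries through the induction because the members added in front are
  applications.\<close>

lemma head_red_standard:
  "A \<rightarrow>\<^sub>h R \<Longrightarrow> \<exists>Ns. standard (Ns @ [R]) \<and> hd (Ns @ [R]) = A \<and>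
    (\<forall>N\<in>set Ns. \<not> begins_lam N \<and> \<not> begins_mu N)"
proof (induction rule: head_red.induct)
  case (lam P)
  show ?case by (rule exI[of _ "[]"]) (simp add: standard_single)
next
  case (mu P)
  show ?case by (rule exI[of _ "[]"]) (simp add: standard_single)
next
  case (contract_beta A P Q R)
  then obtain Ns Ms where Ns: "standard (Ns @ [Lam P])" "hd (Ns @ [Lam P]) = A"
      "\<forall>N\<in>set Ns. \<not> begins_lam N \<and> \<not> begins_mu N"
    and Ms: "standard (Ms @ [R])" "hd (Ms @ [R]) = contract_beta P Q"
      "\<forall>N\<in>set Ms. \<not> begins_lam N \<and> \<not> begins_mu N"
    by blast
  \<comment> \<open>The induction hypothesis splits the continuation at its end, whereas
    \<open>std_beta\<close> expects it split at its head.\<close>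
  have "Ms @ [R] = contract_beta P Q # tl (Ms @ [R])"
    using Ms(2) by (cases Ms) auto
  with std_beta[of Ns P Q "tl (Ms @ [R])"] Ns(1,3) Ms(1)
  have "standard (map (\<lambda>N. App N Q) (Ns @ [Lam P]) @ Ms @ [R])"
    by (metis last_in_set)
  with Ns(2) Ms(3) show ?case
    by (intro exI[of _ "map (\<lambda>N. App N Q) (Ns @ [Lam P]) @ Ms"])
      (cases Ns; auto simp: begins_lam_def begins_mu_def)
next
  case (contract_mu A P s Q)
  then obtain Ns where Ns: "standard (Ns @ [Mu P])" "hd (Ns @ [Mu P]) = A"
      "\<forall>N\<in>set Ns. \<not> begins_lam N \<and> \<not> begins_mu N"
    by blast
  \<comment> \<open>The contractum is the endpoint of the head reduction, so its continuation is a
    one-member sequence.\<close>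
  then have "standard (map (\<lambda>N. app_side s N Q) (Ns @ [Mu P]) @ [contract_mu s P Q])"
    using standard_contract_mu[of Ns P s Q "[]"] standard_single by simp
  with Ns(2) show ?case
    by (intro exI[of _ "map (\<lambda>N. app_side s N Q) (Ns @ [Mu P])"])
      (cases Ns; auto simp: begins_lam_def begins_mu_def)
qed

section \<open>Closure properties of standard reduction\<close>

lemma st_red_map:
  assumes "M \<rhd>\<^sub>s\<^sub>t M'" "\<And>Ms. standard Ms \<Longrightarrow> standard (map f Ms)"
  shows "f M \<rhd>\<^sub>s\<^sub>t f M'"
  using assms unfolding st_red_def by (metis hd_map last_map map_is_Nil_conv)

lemma st_red_App:
  assumes "M \<rhd>\<^sub>s\<^sub>t M'" "N \<rhd>\<^sub>s\<^sub>t N'"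
  shows "App M N \<rhd>\<^sub>s\<^sub>t App M' N'"
proof -
  \<comment> \<open>The two sequences are split at opposite ends, since they are glued at the shared
    member \<open>App M' N\<close>.\<close>
  obtain Ms where Ms: "standard (Ms @ [M'])" "hd (Ms @ [M']) = M"
    using assms(1) unfolding st_red_def by (metis append_butlast_last_id)
  obtain Ns where Ns: "standard (N # Ns)" "last (N # Ns) = N'"
    using assms(2) unfolding st_red_def by (metis list.collapse)
  show ?thesis
    unfolding st_red_def using std_app[OF Ms(1) Ns(1)] Ms(2) Ns(2)
    by (intro exI[of _ "map (\<lambda>N'. App N' N) (Ms @ [M']) @ map (\<lambda>P'. App M' P') Ns"])
      (cases Ms; auto simp: last_map)
qed

lemma st_red_contract_beta:
  assumes "A \<rightarrow>\<^sub>h Lam P" "contract_beta P Q \<rhd>\<^sub>s\<^sub>t R"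
  shows "App A Q \<rhd>\<^sub>s\<^sub>t R"
proof -
  obtain Ns where Ns: "standard (Ns @ [Lam P])" "hd (Ns @ [Lam P]) = A"
      "\<forall>N\<in>set Ns. \<not> begins_lam N \<and> \<not> begins_mu N"
    using head_red_standard[OF assms(1)] by blast
  obtain Ms where Ms: "standard (contract_beta P Q # Ms)" "last (contract_beta P Q # Ms) = R"
    using assms(2) unfolding st_red_def by (metis list.collapse)
  have "standard (map (\<lambda>N. App N Q) (Ns @ [Lam P]) @ contract_beta P Q # Ms)"
    using Ns Ms by (intro std_beta) auto
  with Ns(2) Ms(2) show ?thesis
    unfolding st_red_def
    by (intro exI[of _ "map (\<lambda>N. App N Q) (Ns @ [Lam P]) @ contract_beta P Q # Ms"])
      (cases Ns; auto)
qed

lemma st_red_contract_mu: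
  assumes "A \<rightarrow>\<^sub>h Mu P" "contract_mu s P Q \<rhd>\<^sub>s\<^sub>t R"
  shows "app_side s A Q \<rhd>\<^sub>s\<^sub>t R"
proof -
  obtain Ns where Ns: "standard (Ns @ [Mu P])" "hd (Ns @ [Mu P]) = A"
      "\<forall>N\<in>set Ns. \<not> begins_lam N \<and> \<not> begins_mu N"
    using head_red_standard[OF assms(1)] by blast
  obtain Ms where Ms: "standard (contract_mu s P Q # Ms)" "last (contract_mu s P Q # Ms) = R"
    using assms(2) unfolding st_red_def by (metis list.collapse)
  have "standard (map (\<lambda>N. app_side s N Q) (Ns @ [Mu P]) @ contract_mu s P Q # Ms)"
    using Ns Ms by (intro standard_contract_mu) auto
  with Ns(2) Ms(2) show ?thesis
    unfolding st_red_def
    by (intro exI[of _ "map (\<lambda>N. app_side s N Q) (Ns @ [Mu P]) @ contract_mu s P Q # Ms"])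
      (cases Ns; auto)
qed

lemma std_red_imp_st_red: "M \<Rightarrow>\<^sub>s N \<Longrightarrow> M \<rhd>\<^sub>s\<^sub>t N"
proof (induction rule: std_red.induct)
  case (var x)
  show ?case
    unfolding st_red_def by (intro exI[of _ "[Var x]"]) (simp add: std_var)
qed (auto intro: st_red_map std_lam std_mu std_named st_red_App st_red_contract_beta
    st_red_contract_mu)

theorem theorem5p4:
  fixes M P :: trm
  assumes "M \<rhd>\<^sup>* P"
  shows "M \<rhd>\<^sub>s\<^sub>t P"
  using assms by (intro std_red_imp_st_red reds_imp_std_red)

end
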